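(* Let $\psi\in L^2(\mathbb{R})$, $\{a_j\}_{j\in\mathbb{Z}}\subset\mathbb{R}^+$, $\{c_m\}_{m\in\mathbb{Z}}\subset\mathbb{R}$, $b\neq 0$ real, and let $\Theta$ be a bounded linear operator on $L^2(\mathbb{R})$ such that $\Theta^*$ is hyponormal. Assume that $\{D_{a_j}T_{bk}E_{c_m}\psi\}_{j,k,m\in\mathbb{Z}}$ is a $\Theta$-$IWH$ wave packet frame for $L^2(\mathbb{R})$. Let $\{\mathbb{I}_{r,s,t}\}_{r,s,t\in\mathbb{Z}}$ be subsets of $\mathbb{Z}^3$ with $\bigcup_{r,s,t\in\mathbb{Z}}\mathbb{I}_{r,s,t}=\mathbb{Z}\times\mathbb{Z}\times\mathbb{Z}$ and $\mathbb{I}_{r,s,t}\cap\mathbb{I}_{r',s',t'}=\emptyset$ whenever $(r,s,t)\neq(r',s',t')$, let $\alpha_{j,k,m}$ $(j,k,m\in\mathbb{Z})$ be scalars, and let $\{\Phi_{r,s,t}\}_{r,s,t\in\mathbb{Z}}\subset L^2(\mathbb{R})$ be given by $$\Phi_{r,s,t}=\sum_{(j,k,m)\in\mathbb{I}_{r,s,t}}\alpha_{j,k,m}D_{a_j}T_{bk}E_{c_m}\psi,\qquad r,s,t\in\mathbb{Z}.$$ Let $T:\ell^2(\mathbb{Z}^3)\to\ell^2(\mathbb{Z}^3)$ be a bounded linear operator such that $$T\big(\{\langle D_{a_j}T_{bk}E_{c_m}\psi,f\rangle\}_{j,k,m\in\mathbb{Z}}\big)=\{\langle\Phi_{r,s,t},f\rangle\}_{r,s,t\in\mathbb{Z}},\qquad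 f\in L^2(\mathbb{R}).$$ Then $\{\Phi_{r,s,t}\}_{r,s,t\in\mathbb{Z}}$ is a $\Theta$-$IWH$ wave packet frame for $L^2(\mathbb{R})$ if and only if there exists a constant $\lambda>0$ such that $$\sum_{r,s,t\in\mathbb{Z}}|\langle\Phi_{r,s,t},f\rangle|^2\geq\lambda\sum_{j,k,m\in\mathbb{Z}}|\langle D_{a_j}T_{bk}E_{c_m}\psi,f\rangle|^2\quad\text{for all } f\in L^2(\mathbb{R}).$$
   Context: For $f\in L^2(\mathbb{R})$: $T_af(t)=f(t-a)$ (translation, $a\in\mathbb{R}$), $E_bf(t)=e^{2\pi i bt}f(t)$ (modulation, $b\in\mathbb{R}$), $D_cf(t)=|c|^{1/2}f(ct)$ (dilation, $c\neq0$). A bounded linear operator $S$ on a Hilbert space is hyponormal if $\|S^*f\|\leq\|Sf\|$ for all $f$; so $\Theta^*$ hyponormal means $\|\Theta f\|\leq\|\Theta^*f\|$ for all $f$. Definition. For a bounded linear operator $\Theta$ on $L^2(\mathbb{R})$, a system $\{g_{j,k,m}\}_{j,k,m\in\mathbb{Z}}\subset L^2(\mathbb{R})$ (in particular $g_{j,k,m}=D_{a_j}T_{bk}E_{c_m}\psi$ or $g_{r,s,t}=\Phi_{r,s,t}$) is called a $\Theta$-$IWH$ ($\Theta$-irregular Weyl-Heisenberg) wave packet frame for $L^2(\mathbb{R})$ if there exist constants $0<\alpha_0\leq\beta_0<\infty$ such that $$\alpha_0\|\Theta^*f\|^2\leq\sum_{j,k,m\in\mathbb{Z}}|\langle f,g_{j,k,m}\rangle|^2\leq\beta_0\|\Theta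 f\|^2\quad\text{for all } f\in L^2(\mathbb{R}).$$ *)

theory Defs
  imports "HOL-Analysis.Analysis"
begin

definition square_integrable :: "(real \<Rightarrow> complex) \<Rightarrow> bool" where
  "square_integrable f \<longleftrightarrow>
     f \<in> borel_measurable lborel \<and> integrable lborel (\<lambda>x. (cmod (f x))\<^sup>2)"

definition L2_eq :: "(real \<Rightarrow> complex) \<Rightarrow> (real \<Rightarrow> complex) \<Rightarrow> bool" where
  "L2_eq f g \<longleftrightarrow>
     square_integrable f \<and> square_integrable g \<and> (AE x in lborel. f x = g x)"

lemma borel_measurable_cnj [measurable (raw)]:
  "f \<in> borel_measurable M \<Longrightarrow> (\<lambda>x. cnj (f x)) \<in> borel_measurable M"
  by (erule borel_measurable_continuous_on[rotated]) (intro continuous_intros)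

lemma square_integrable_zero: "square_integrable (\<lambda>_. 0)"
  by (simp add: square_integrable_def)

lemma square_integrable_mult_cnj:
  assumes "square_integrable f" "square_integrable g"
  shows "integrable lborel (\<lambda>x. f x * cnj (g x))"
proof -
  have [measurable]: "f \<in> borel_measurable borel" "g \<in> borel_measurable borel"
    using assms by (auto simp: square_integrable_def)
  have int: "integrable lborel (\<lambda>x. (cmod (f x))\<^sup>2 + (cmod (g x))\<^sup>2)"
    using assms by (auto simp: square_integrable_def)
  have le: "cmod (f x * cnj (g x)) \<le> norm ((cmod (f x))\<^sup>2 + (cmod (g x))\<^sup>2)" for x
  proof -
    have "2 * (cmod (f x) * cmod (g x)) \<le> (cmod (f x))\<^sup>2 + (cmod (g x))\<^sup>2"
      using sum_squares_bound[of "cmod (f x)" "cmod (g x)"] by simp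
    moreover have "0 \<le> cmod (f x) * cmod (g x)"
      by simp
    ultimately show ?thesis
      unfolding norm_mult complex_mod_cnj real_norm_def by linarith
  qed
  show ?thesis
    by (rule Bochner_Integration.integrable_bound[OF int]) (use le in auto)
qed

lemma square_integrable_add:
  assumes "square_integrable f" "square_integrable g"
  shows "square_integrable (\<lambda>x. f x + g x)"
proof -
  have [measurable]: "f \<in> borel_measurable borel" "g \<in> borel_measurable borel"
    using assms by (auto simp: square_integrable_def)
  have int: "integrable lborel (\<lambda>x. 2 * (cmod (f x))\<^sup>2 + 2 * (cmod (g x))\<^sup>2)"
    using assms by (auto simp: square_integrable_def)
  have le: "(cmod (f x + g x))\<^sup>2 \<le> 2 * (cmod (f x))\<^sup>2 + 2 * (cmod (g x))\<^sup>2" for x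
  proof -
    have "(cmod (f x + g x))\<^sup>2 \<le> (cmod (f x) + cmod (g x))\<^sup>2"
      by (intro power_mono norm_triangle_ineq) auto
    also have "\<dots> \<le> 2 * (cmod (f x))\<^sup>2 + 2 * (cmod (g x))\<^sup>2"
      using sum_squares_bound[of "cmod (f x)" "cmod (g x)"] by (simp add: power2_sum)
    finally show ?thesis .
  qed
  have "integrable lborel (\<lambda>x. (cmod (f x + g x))\<^sup>2)"
    by (rule Bochner_Integration.integrable_bound[OF int]) (use le in auto)
  then show ?thesis
    by (simp add: square_integrable_def)
qed

lemma square_integrable_mult:
  assumes "square_integrable f" "u \<in> borel_measurable borel" "\<And>x. cmod (u x) = r"
  shows "square_integrable (\<lambda>x. u x * f x)"
  using assms by (auto simp: square_integrable_def norm_mult power_mult_distrib)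

lemma square_integrable_affine:
  assumes f: "square_integrable f" and c: "c \<noteq> 0"
  shows "square_integrable (\<lambda>x. f (t + c * x))"
proof -
  have [measurable]: "f \<in> borel_measurable borel"
    using f by (auto simp: square_integrable_def)
  show ?thesis
    using f lborel_integrable_real_affine[of "\<lambda>x. (cmod (f x))\<^sup>2" c t] c
    by (simp add: square_integrable_def)
qed

lemma L2_eq_affine:
  assumes fg: "L2_eq f g" and c: "c \<noteq> 0"
  shows "L2_eq (\<lambda>x. f (t + c * x)) (\<lambda>x. g (t + c * x))"
proof -
  have [measurable]: "f \<in> borel_measurable borel" "g \<in> borel_measurable borel"
    using fg by (auto simp: square_integrable_def L2_eq_def)
  show ?thesis
    using fg c AE_borel_affine[of c "\<lambda>x. f x = g x" t]
    by (auto simp: L2_eq_def intro: square_integrable_affine)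
qed

lemma L2_eq_mult:
  assumes "L2_eq f g" "u \<in> borel_measurable borel" "\<And>x. cmod (u x) = r"
  shows "L2_eq (\<lambda>x. u x * f x) (\<lambda>x. u x * g x)"
  using assms by (auto simp: L2_eq_def intro: square_integrable_mult)

text \<open>
  \<open>L2\<close> is $L^2(\mathbb{R})$.  Borel representatives suffice, since every Lebesgue measurable
  function agrees almost everywhere with a Borel measurable one.
\<close>

quotient_type L2 = "real \<Rightarrow> complex" / partial: L2_eq
proof (rule part_equivpI)
  show "\<exists>f. L2_eq f f"
    using square_integrable_zero by (auto simp: L2_eq_def)
  show "symp L2_eq"
    by (auto simp: symp_def L2_eq_def)
  show "transp L2_eq"
    by (auto simp: transp_def L2_eq_def)
qed

text \<open>The inner product is linear in its first argument.\<close>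

lift_definition cinner :: "L2 \<Rightarrow> L2 \<Rightarrow> complex" is
  "\<lambda>f g. \<integral>x. f x * cnj (g x) \<partial>lborel"
  by (rule integral_cong_AE) (auto simp: L2_eq_def square_integrable_def)

lift_definition scaleC :: "complex \<Rightarrow> L2 \<Rightarrow> L2" (infixr "*\<^sub>C" 75) is
  "\<lambda>c f x. c * f x"
  by (rule L2_eq_mult) auto

instantiation L2 :: real_vector
begin

lift_definition zero_L2 :: L2 is "\<lambda>_. 0"
  by (simp add: L2_eq_def square_integrable_zero)

lift_definition plus_L2 :: "L2 \<Rightarrow> L2 \<Rightarrow> L2" is "\<lambda>f g x. f x + g x"
  by (auto simp: L2_eq_def intro: square_integrable_add)

definition scaleR_L2 :: "real \<Rightarrow> L2 \<Rightarrow> L2" where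
  "scaleR_L2 r f = complex_of_real r *\<^sub>C f"

definition uminus_L2 :: "L2 \<Rightarrow> L2" where
  "uminus_L2 f = (- 1) *\<^sub>C f"

definition minus_L2 :: "L2 \<Rightarrow> L2 \<Rightarrow> L2" where
  "minus_L2 f g = f + - (g :: L2)"

instance
proof
  fix f g h :: L2 and r s :: real
  show "f + g + h = f + (g + h)"
    by transfer (auto simp: L2_eq_def add.assoc intro!: square_integrable_add)
  show "f + g = g + f"
    by transfer (auto simp: L2_eq_def add.commute intro!: square_integrable_add)
  show "0 + f = f"
    by transfer (auto simp: L2_eq_def)
  show "- f + f = 0"
    unfolding uminus_L2_def by transfer (auto simp: L2_eq_def square_integrable_zero)
  show "f - g = f + - g"
    by (fact minus_L2_def)
  show "r *\<^sub>R (f + g) = r *\<^sub>R f + r *\<^sub>R g"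
    unfolding scaleR_L2_def
    by transfer (auto simp: L2_eq_def ring_distribs
        intro!: square_integrable_add square_integrable_mult)
  show "(r + s) *\<^sub>R f = r *\<^sub>R f + s *\<^sub>R f"
    unfolding scaleR_L2_def
    by transfer (auto simp: L2_eq_def ring_distribs
        intro!: square_integrable_add square_integrable_mult)
  show "r *\<^sub>R s *\<^sub>R f = (r * s) *\<^sub>R f"
    unfolding scaleR_L2_def
    by transfer (auto simp: L2_eq_def mult.assoc
        intro!: square_integrable_mult)
  show "1 *\<^sub>R f = f"
    unfolding scaleR_L2_def by transfer (auto simp: L2_eq_def)
qed

end

instantiation L2 :: real_inner
begin

definition inner_L2 :: "L2 \<Rightarrow> L2 \<Rightarrow> real" where
  "inner_L2 f g = Re (cinner f g)"

definition norm_L2 :: "L2 \<Rightarrow> real" where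
  "norm_L2 f = sqrt (inner f f)"

definition dist_L2 :: "L2 \<Rightarrow> L2 \<Rightarrow> real" where
  "dist_L2 f g = norm (f - g)"

definition sgn_L2 :: "L2 \<Rightarrow> L2" where
  "sgn_L2 f = f /\<^sub>R norm f"

definition uniformity_L2 :: "(L2 \<times> L2) filter" where
  "uniformity_L2 = (INF e\<in>{0<..}. principal {(f, g). dist f g < e})"

definition open_L2 :: "L2 set \<Rightarrow> bool" where
  "open_L2 U \<longleftrightarrow> (\<forall>f\<in>U. \<forall>\<^sub>F (f', g) in uniformity. f' = f \<longrightarrow> g \<in> U)"

instance
proof
  fix f g h :: L2 and r :: real
  show "dist f g = norm (f - g)"
    by (fact dist_L2_def)
  show "sgn f = f /\<^sub>R norm f"
    by (fact sgn_L2_def)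
  show "uniformity = (INF e\<in>{0<..}. principal {(f :: L2, g). dist f g < e})"
    by (fact uniformity_L2_def)
  show "open U \<longleftrightarrow> (\<forall>f\<in>U. \<forall>\<^sub>F (f', g) in uniformity. f' = f \<longrightarrow> g \<in> U)" for U :: "L2 set"
    by (fact open_L2_def)
  show "inner f g = inner g f"
    unfolding inner_L2_def
  proof transfer
    fix f g :: "real \<Rightarrow> complex"
    have "(\<integral>x. f x * cnj (g x) \<partial>lborel) = cnj (\<integral>x. g x * cnj (f x) \<partial>lborel)"
      unfolding Bochner_Integration.integral_cnj[symmetric] by (simp add: mult.commute)
    then show "Re (\<integral>x. f x * cnj (g x) \<partial>lborel) = Re (\<integral>x. g x * cnj (f x) \<partial>lborel)"
      by simp
  qed
  show "inner (f + g) h = inner f h + inner g h"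
    unfolding inner_L2_def
    by transfer (auto simp: L2_eq_def ring_distribs square_integrable_mult_cnj)
  show "inner (r *\<^sub>R f) g = r * inner f g"
    unfolding inner_L2_def scaleR_L2_def by transfer (simp add: mult.assoc)
  have sq: "Re (\<integral>x. u x * cnj (u x) \<partial>lborel) = (\<integral>x. (cmod (u x))\<^sup>2 \<partial>lborel)"
    for u :: "real \<Rightarrow> complex"
    by (simp add: complex_norm_square[symmetric] flip: of_real_power)
  show "0 \<le> inner f f"
    unfolding inner_L2_def by transfer (simp only: sq, simp)
  show "inner f f = 0 \<longleftrightarrow> f = 0"
    unfolding inner_L2_def
    by transfer (simp only: sq, auto simp: L2_eq_def square_integrable_def
        integral_nonneg_eq_0_iff_AE)
  show "norm f = sqrt (inner f f)"
    by (fact norm_L2_def)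
qed

end

lemma dist_abs_L2:
  assumes u: "square_integrable u" and v: "square_integrable v"
  shows "(\<integral>\<^sup>+x. ennreal ((cmod (u x - v x))\<^sup>2) \<partial>lborel) = ennreal ((dist (abs_L2 u) (abs_L2 v))\<^sup>2)"
proof -
  have uv: "square_integrable (\<lambda>x. u x - v x)"
    using square_integrable_add[OF u square_integrable_mult[OF v, of "\<lambda>_. - 1" 1]] by simp
  have "abs_L2 u - abs_L2 v = abs_L2 (\<lambda>x. u x - v x)"
    unfolding minus_L2_def uminus_L2_def using u v square_integrable_mult[OF v, of "\<lambda>_. - 1" 1]
    by (simp add: plus_L2.abs_eq scaleC.abs_eq L2_eq_def)
  then have "(dist (abs_L2 u) (abs_L2 v))\<^sup>2 = Re (\<integral>x. (u x - v x) * cnj (u x - v x) \<partial>lborel)"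
    using uv by (simp add: dist_norm power2_norm_eq_inner inner_L2_def cinner.abs_eq L2_eq_def)
  also have "\<dots> = (\<integral>x. (cmod (u x - v x))\<^sup>2 \<partial>lborel)"
    by (simp only: complex_norm_square[symmetric] integral_complex_of_real Re_complex_of_real
        flip: of_real_power)
  finally show ?thesis
    using uv by (subst nn_integral_eq_integral) (auto simp: square_integrable_def)
qed

lemma abs_L2_surj: "\<exists>u. square_integrable u \<and> abs_L2 u = f"
  by (rule L2.abs_induct) (auto simp: L2_eq_def)

instance L2 :: complete_space
proof
  fix X :: "nat \<Rightarrow> L2"
  assume X: "Cauchy X"
  have "\<forall>n. \<exists>N. \<forall>m\<ge>N. \<forall>m'\<ge>N. dist (X m) (X m') < (1/2)^n"
    using metric_CauchyD[OF X] by simp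
  then obtain N where N: "\<And>n m m'. m \<ge> N n \<Longrightarrow> m' \<ge> N n \<Longrightarrow> dist (X m) (X m') < (1/2)^n"
    by metis
  define r where "r n = n + (\<Sum>k\<le>n. N k)" for n
  have r_ge: "r m \<ge> N n" if "n \<le> m" for n m
    using member_le_sum[of n "{..m}" N] that by (simp add: r_def)
  have r: "strict_mono r"
    by (rule strict_monoI_Suc) (simp add: r_def)
  obtain u where u: "\<And>n. square_integrable (u n)" "\<And>n. abs_L2 (u n) = X (r n)"
    using choice[of "\<lambda>n u. square_integrable u \<and> abs_L2 u = X (r n)"] abs_L2_surj by blast
  have [measurable]: "u n \<in> borel_measurable borel" for n
    using u(1) by (auto simp: square_integrable_def)
  have pow: "((1/2)^n)\<^sup>2 = ((1/4)^n :: real)" for n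
    by (simp add: power2_eq_square flip: power_mult_distrib)
  have d: "(\<integral>\<^sup>+x. ennreal ((cmod (u m x - u n x))\<^sup>2) \<partial>lborel) \<le> ennreal ((1/4)^n)" if "n \<le> m" for m n
  proof -
    have "(dist (X (r m)) (X (r n)))\<^sup>2 \<le> ((1/2)^n)\<^sup>2"
      by (intro power_mono less_imp_le[OF N] r_ge that) auto
    then show ?thesis
      by (simp add: dist_abs_L2 u ennreal_leI pow)
  qed
  have "(\<integral>\<^sup>+x. (\<Sum>n. ennreal (2^n * (cmod (u (Suc n) x - u n x))\<^sup>2)) \<partial>lborel)
      = (\<Sum>n. \<integral>\<^sup>+x. ennreal (2^n * (cmod (u (Suc n) x - u n x))\<^sup>2) \<partial>lborel)"
    by (rule nn_integral_suminf) simp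
  also have "\<dots> \<le> (\<Sum>n. ennreal ((1/2)^n))"
  proof (intro suminf_le allI)
    fix n
    have "(\<integral>\<^sup>+x. ennreal (2^n * (cmod (u (Suc n) x - u n x))\<^sup>2) \<partial>lborel)
        = ennreal (2^n) * (\<integral>\<^sup>+x. ennreal ((cmod (u (Suc n) x - u n x))\<^sup>2) \<partial>lborel)"
      by (simp add: ennreal_mult nn_integral_cmult)
    also have "\<dots> \<le> ennreal (2^n) * ennreal ((1/4)^n)"
      by (intro mult_left_mono d) auto
    also have "\<dots> = ennreal ((1/2)^n)"
      by (simp flip: ennreal_mult power_mult_distrib)
    finally show "(\<integral>\<^sup>+x. ennreal (2^n * (cmod (u (Suc n) x - u n x))\<^sup>2) \<partial>lborel) \<le> ennreal ((1/2)^n)" .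
  qed auto
  also have "\<dots> < \<infinity>"
    by (subst suminf_ennreal2) auto
  finally have "AE x in lborel. (\<Sum>n. ennreal (2^n * (cmod (u (Suc n) x - u n x))\<^sup>2)) \<noteq> \<infinity>"
    by (intro nn_integral_PInf_AE) auto
  then have conv: "AE x in lborel. convergent (\<lambda>n. u n x)"
  proof eventually_elim
    case (elim x)
    let ?d = "\<lambda>n. cmod (u (Suc n) x - u n x)"
    have "summable (\<lambda>n. 2^n * (?d n)\<^sup>2)"
      using elim by (intro summable_suminf_not_top) auto
    then have "(\<lambda>n. 2^n * (?d n)\<^sup>2) \<longlonglongrightarrow> 0"
      by (rule summable_LIMSEQ_zero)
    then have "\<forall>\<^sub>F n in sequentially. 2^n * (?d n)\<^sup>2 < 1"
      by (rule order_tendstoD) simp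
    then have "\<forall>\<^sub>F n in sequentially. norm (u (Suc n) x - u n x) \<le> (sqrt (1/2))^n"
    proof eventually_elim
      case (elim n)
      then have "(?d n)\<^sup>2 \<le> (1/2)^n"
        by (simp add: field_simps power_divide)
      then have "?d n \<le> sqrt ((1/2)^n)"
        by (rule real_le_rsqrt)
      then show ?case
        by (simp add: real_sqrt_power)
    qed
    then have "summable (\<lambda>n. u (Suc n) x - u n x)"
      by (rule summable_comparison_test_ev) (auto intro!: summable_geometric)
    then have "convergent (\<lambda>n. (\<Sum>k<n. u (Suc k) x - u k x) + u 0 x)"
      by (intro convergent_add convergent_const) (simp only: summable_iff_convergent)
    moreover have "(\<Sum>k<n. u (Suc k) x - u k x) + u 0 x = u n x" for n
      using sum_lessThan_telescope[of "\<lambda>k. u k x" n] by simp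
    ultimately show ?case
      by simp
  qed
  define U where "U x = lim (\<lambda>n. u n x)" for x
  have [measurable]: "U \<in> borel_measurable borel"
    unfolding U_def by measurable
  have fatou: "(\<integral>\<^sup>+x. ennreal ((cmod (U x - u n x))\<^sup>2) \<partial>lborel) \<le> ennreal ((1/4)^n)" for n
  proof -
    have "(\<integral>\<^sup>+x. ennreal ((cmod (U x - u n x))\<^sup>2) \<partial>lborel)
        = (\<integral>\<^sup>+x. liminf (\<lambda>m. ennreal ((cmod (u m x - u n x))\<^sup>2)) \<partial>lborel)"
    proof (rule nn_integral_cong_AE, use conv in eventually_elim)
      case (elim x)
      then have "(\<lambda>m. u m x) \<longlonglongrightarrow> U x"
        by (simp add: U_def convergent_LIMSEQ_iff)
      then have "(\<lambda>m. ennreal ((cmod (u m x - u n x))\<^sup>2)) \<longlonglongrightarrow> ennreal ((cmod (U x - u n x))\<^sup>2)"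
        by (intro tendsto_intros)
      then show ?case
        by (rule lim_imp_Liminf[OF sequentially_bot, symmetric])
    qed
    also have "\<dots> \<le> liminf (\<lambda>m. \<integral>\<^sup>+x. ennreal ((cmod (u m x - u n x))\<^sup>2) \<partial>lborel)"
      by (rule nn_integral_liminf) simp
    also have "\<dots> \<le> liminf (\<lambda>m. ennreal ((1/4)^n))"
      by (intro Liminf_mono eventually_sequentiallyI[of n] d)
    finally show ?thesis
      by (simp add: Liminf_const)
  qed
  have "integrable lborel (\<lambda>x. (cmod (U x - u 0 x))\<^sup>2)"
  proof (rule integrableI_bounded)
    show "(\<integral>\<^sup>+x. ennreal (norm ((cmod (U x - u 0 x))\<^sup>2)) \<partial>lborel) < \<infinity>"
      using order_le_less_trans[OF fatou[of 0], of \<infinity>] by simp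
  qed simp
  then have "square_integrable (\<lambda>x. U x - u 0 x)"
    by (simp add: square_integrable_def)
  then have U: "square_integrable U"
    using square_integrable_add[OF _ u(1)[of 0], of "\<lambda>x. U x - u 0 x"] by simp
  have le: "dist (X (r n)) (abs_L2 U) \<le> (1/2)^n" for n
  proof -
    have "ennreal ((dist (abs_L2 U) (X (r n)))\<^sup>2) \<le> ennreal ((1/4)^n)"
      using fatou[of n] dist_abs_L2[OF U u(1)[of n]] by (simp add: u(2))
    then have "(dist (abs_L2 U) (X (r n)))\<^sup>2 \<le> ((1/2)^n)\<^sup>2"
      by (simp add: pow)
    then show ?thesis
      by (subst dist_commute) (rule power2_le_imp_le, auto)
  qed
  have "(\<lambda>n. dist ((X \<circ> r) n) (abs_L2 U)) \<longlonglongrightarrow> 0"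
    by (rule tendsto_sandwich[where f = "\<lambda>_. 0" and h = "\<lambda>n. (1/2)^n"])
      (auto simp: le intro!: LIMSEQ_power_zero)
  then have "(X \<circ> r) \<longlonglongrightarrow> abs_L2 U"
    by (simp only: tendsto_dist_iff[symmetric])
  then show "convergent X"
    using Cauchy_converges_subseq[OF X r] by (auto simp: convergent_def)
qed

lemma riesz_representation:
  fixes \<phi> :: "'a :: {real_inner, complete_space} \<Rightarrow> real"
  assumes "bounded_linear \<phi>"
  shows "\<exists>z. \<forall>x. \<phi> x = inner x z"
proof -
  interpret \<phi>: bounded_linear \<phi> by fact
  define J where "J x = (norm x)\<^sup>2 / 2 - \<phi> x" for x
  obtain K where K: "\<And>x. \<bar>\<phi> x\<bar> \<le> norm x * K"
    using \<phi>.bounded by auto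
  have "- K\<^sup>2 / 2 \<le> J x" for x
    using K[of x] sum_squares_bound[of "norm x" K] by (simp add: J_def)
  then have bdd: "bdd_below (range J)"
    by (auto simp: bdd_below_def)
  define m where "m = Inf (range J)"
  have m: "m \<le> J x" for x
    unfolding m_def by (rule cInf_lower) (auto simp: bdd)
  have "\<exists>x. J x < m + 1 / real (Suc n)" for n
    using cInf_lessD[of "range J" "m + 1 / real (Suc n)"] by (auto simp: m_def)
  then obtain X where X: "\<And>n. J (X n) < m + 1 / real (Suc n)"
    by metis
  have par: "(dist x y)\<^sup>2 / 4 \<le> (J x - m) + (J y - m)" for x y
  proof -
    have "(norm (x - y))\<^sup>2 / 4 = J x + J y - 2 * J ((1/2) *\<^sub>R (x + y))"
      unfolding J_def \<phi>.scaleR \<phi>.add power2_norm_eq_inner inner_simps inner_commute[of y x]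
      by (simp add: field_simps)
    then show ?thesis
      using m[of "(1/2) *\<^sub>R (x + y)"] by (simp add: dist_norm)
  qed
  have "Cauchy X"
  proof (rule metric_CauchyI)
    fix e :: real
    assume "e > 0"
    then obtain M where M: "8 / e\<^sup>2 < real M"
      using reals_Archimedean2 by blast
    have small: "J (X n) - m < e\<^sup>2 / 8" if "n \<ge> M" for n
    proof -
      have "8 / e\<^sup>2 < real (Suc n)"
        using M that by linarith
      then have "1 / real (Suc n) < e\<^sup>2 / 8"
        using \<open>e > 0\<close> by (simp add: field_simps)
      then show ?thesis
        using X[of n] by linarith
    qed
    have "dist (X n) (X n') < e" if "n \<ge> M" "n' \<ge> M" for n n'
    proof (rule power2_less_imp_less)
      show "(dist (X n) (X n'))\<^sup>2 < e\<^sup>2"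
        using par[of "X n" "X n'"] small[OF that(1)] small[OF that(2)] by linarith
    qed (use \<open>e > 0\<close> in simp)
    then show "\<exists>M. \<forall>n\<ge>M. \<forall>n'\<ge>M. dist (X n) (X n') < e"
      by blast
  qed
  then obtain z where z: "X \<longlonglongrightarrow> z"
    using Cauchy_convergent convergent_def by blast
  have "(\<lambda>n. J (X n)) \<longlonglongrightarrow> J z"
    unfolding J_def by (intro tendsto_intros \<phi>.tendsto z) auto
  moreover have "(\<lambda>n. m + 1 / real (Suc n)) \<longlonglongrightarrow> m + 0"
    by (intro tendsto_intros LIMSEQ_Suc[OF lim_1_over_n])
  ultimately have "J z \<le> m + 0"
    by (rule LIMSEQ_le) (use X less_imp_le in blast)
  then have min: "J z \<le> J x" for x
    using m[of x] by simp
  have "\<phi> x = inner x z" for x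
  proof -
    define d where "d = inner x z - \<phi> x"
    define s where "s = 1 / ((norm x)\<^sup>2 + 1)"
    have "(norm x)\<^sup>2 + 1 > 0"
      by (simp add: add_nonneg_pos)
    then have s: "s > 0" "s * (norm x)\<^sup>2 = 1 - s"
      by (auto simp: s_def field_simps)
    have "J (z + t *\<^sub>R x) - J z = t * d + t\<^sup>2 * (norm x)\<^sup>2 / 2" for t
      unfolding J_def d_def \<phi>.add \<phi>.scaleR power2_norm_eq_inner inner_simps inner_commute[of z x]
      by (simp add: power2_eq_square algebra_simps add_divide_distrib)
    from this[of "- d * s"]
    have "J (z + (- d * s) *\<^sub>R x) - J z = - d\<^sup>2 * s + d\<^sup>2 * s * (s * (norm x)\<^sup>2) / 2"
      by (simp add: power2_eq_square mult_ac)
    also have "\<dots> = - (d\<^sup>2 * s * (1 + s) / 2)"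
      unfolding s(2) by (simp add: algebra_simps diff_divide_distrib add_divide_distrib)
    finally have "d\<^sup>2 * s * (1 + s) \<le> 0"
      using min[of "z + (- d * s) *\<^sub>R x"] by linarith
    then have "d\<^sup>2 * (s * (1 + s)) \<le> 0"
      by (simp only: mult.assoc)
    moreover have "s * (1 + s) > 0"
      using s(1) by simp
    ultimately have "d = 0"
      by (meson mult_pos_pos not_le zero_less_power2)
    then show ?thesis
      by (simp add: d_def)
  qed
  then show ?thesis
    by blast
qed

text \<open>The operators $T_a$, $E_b$ and $D_c$ on $L^2(\mathbb{R})$.\<close>

lift_definition translation :: "real \<Rightarrow> L2 \<Rightarrow> L2" is
  "\<lambda>a f t. f (t - a)"
  subgoal for a f g using L2_eq_affine[of f g 1 "- a"] by simp
  done

lift_definition modulation :: "real \<Rightarrow> L2 \<Rightarrow> L2" is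
  "\<lambda>b f t. exp (2 * complex_of_real pi * \<i> * complex_of_real (b * t)) * f t"
  by (rule L2_eq_mult[where r = 1]) auto

lift_definition dilation :: "real \<Rightarrow> L2 \<Rightarrow> L2" is
  "\<lambda>c f t. complex_of_real (\<bar>c\<bar> powr (1/2)) * f (c * t)"
  subgoal for c f g
    using L2_eq_mult[OF L2_eq_affine[of f g c 0], of "\<lambda>_. complex_of_real (\<bar>c\<bar> powr (1/2))"]
    by (cases "c = 0") (auto simp: L2_eq_def square_integrable_zero)
  done

definition wave_packet ::
    "L2 \<Rightarrow> (int \<Rightarrow> real) \<Rightarrow> real \<Rightarrow> (int \<Rightarrow> real) \<Rightarrow> int \<times> int \<times> int \<Rightarrow> L2" where
  "wave_packet \<psi> a b c =
     (\<lambda>(j, k, m). dilation (a j) (translation (b * of_int k) (modulation (c m) \<psi>)))"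

text \<open>\<open>bounded_linear\<close> alone only says real-linear.\<close>

definition bounded_clinear :: "(L2 \<Rightarrow> L2) \<Rightarrow> bool" where
  "bounded_clinear S \<longleftrightarrow> bounded_linear S \<and> (\<forall>c f. S (c *\<^sub>C f) = c *\<^sub>C S f)"

definition cadjoint :: "(L2 \<Rightarrow> L2) \<Rightarrow> L2 \<Rightarrow> L2" where
  "cadjoint S = (THE S'. \<forall>f g. cinner (S f) g = cinner f (S' g))"

lemma cinner_scaleC_left: "cinner (c *\<^sub>C f) g = c * cinner f g"
  by transfer (simp add: mult.assoc)

text \<open>The defining property determines the adjoint, so \<open>cadjoint\<close> is well defined.\<close>

lemma cadjoint_ex1:
  assumes S: "bounded_clinear S"
  shows "\<exists>!S'. \<forall>f g. cinner (S f) g = cinner f (S' g)"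
proof (rule ex_ex1I)
  have "\<exists>z. \<forall>f. cinner (S f) g = cinner f z" for g
  proof -
    have "bounded_linear (\<lambda>f. inner (S f) g)"
      using S bounded_linear_compose[OF bounded_linear_inner_left]
      by (auto simp: bounded_clinear_def)
    then obtain z where z: "\<And>f. inner (S f) g = inner f z"
      using riesz_representation by blast
    have "cinner (S f) g = cinner f z" for f
      using z[of f] z[of "\<i> *\<^sub>C f"] S
      by (simp add: bounded_clinear_def inner_L2_def cinner_scaleC_left complex_eq_iff)
    then show ?thesis
      by blast
  qed
  then show "\<exists>S'. \<forall>f g. cinner (S f) g = cinner f (S' g)"
    by metis
next
  fix S1 S2
  assume S1: "\<forall>f g. cinner (S f) g = cinner f (S1 g)"
    and S2: "\<forall>f g. cinner (S f) g = cinner f (S2 g)"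
  show "S1 = S2"
  proof
    fix g
    have "inner f (S1 g) = inner f (S2 g)" for f
      using S1 S2 by (simp add: inner_L2_def)
    then have "inner f (S1 g - S2 g) = 0" for f
      by (simp add: inner_diff_right)
    from this[of "S1 g - S2 g"] show "S1 g = S2 g"
      by simp
  qed
qed

definition hyponormal :: "(L2 \<Rightarrow> L2) \<Rightarrow> bool" where
  "hyponormal S \<longleftrightarrow> (\<forall>f. norm (cadjoint S f) \<le> norm (S f))"

text \<open>
  The sum is taken in $[0,\infty]$: an unordered real sum would be \<open>0\<close> when it diverges.
\<close>

definition IWH_frame :: "(L2 \<Rightarrow> L2) \<Rightarrow> (int \<times> int \<times> int \<Rightarrow> L2) \<Rightarrow> bool" where
  "IWH_frame \<Theta> g \<longleftrightarrow>
     (\<exists>\<alpha>\<^sub>0 \<beta>\<^sub>0 :: real. 0 < \<alpha>\<^sub>0 \<and> \<alpha>\<^sub>0 \<le> \<beta>\<^sub>0 \<and>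
       (\<forall>f. ennreal (\<alpha>\<^sub>0 * (norm (cadjoint \<Theta> f))\<^sup>2)
              \<le> (\<Sum>\<^sub>\<infinity>i. ennreal ((cmod (cinner f (g i)))\<^sup>2)) \<and>
            (\<Sum>\<^sub>\<infinity>i. ennreal ((cmod (cinner f (g i)))\<^sup>2))
              \<le> ennreal (\<beta>\<^sub>0 * (norm (\<Theta> f))\<^sup>2)))"

definition ell2 :: "(int \<times> int \<times> int \<Rightarrow> complex) set" where
  "ell2 = {x. (\<lambda>i. (cmod (x i))\<^sup>2) summable_on UNIV}"

definition ell2_norm :: "(int \<times> int \<times> int \<Rightarrow> complex) \<Rightarrow> real" where
  "ell2_norm x = sqrt (\<Sum>\<^sub>\<infinity>i. (cmod (x i))\<^sup>2)"

text \<open>\<open>T\<close> is unconstrained outside \<open>ell2\<close>.\<close>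

definition bounded_clinear_ell2 ::
    "((int \<times> int \<times> int \<Rightarrow> complex) \<Rightarrow> (int \<times> int \<times> int \<Rightarrow> complex)) \<Rightarrow> bool" where
  "bounded_clinear_ell2 T \<longleftrightarrow>
     (\<forall>x\<in>ell2. T x \<in> ell2) \<and>
     (\<forall>x\<in>ell2. \<forall>y\<in>ell2. T (\<lambda>i. x i + y i) = (\<lambda>i. T x i + T y i)) \<and>
     (\<forall>c. \<forall>x\<in>ell2. T (\<lambda>i. c * x i) = (\<lambda>i. c * T x i)) \<and>
     (\<exists>K. \<forall>x\<in>ell2. ell2_norm (T x) \<le> K * ell2_norm x)"

end

theory Submission
  imports Defs
begin

text \<open>
  Write $N(f)$ and $M(f)$ for the sums of squared coefficients of \<open>f\<close> with respect to the wave
  packets and to $\Phi$.  Three comparisons carry the proof.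

  The boundedness of \<open>T\<close>, which maps the first coefficient sequence to the second, gives
  $M \le K^2 N$ (\<open>bounded_clinear_ell2_square_sum_le\<close>).  Hyponormality of $\Theta^*$, together with
  $\Theta^{**} = \Theta$, gives $\|\Theta f\| \le \|\Theta^* f\|$ (\<open>hyponormal_cadjoint_norm_le\<close>).
  The given frame inequalities sandwich $N$ between multiples of $\|\Theta^* f\|^2$ and
  $\|\Theta f\|^2$.

  Hence the upper frame bound for $\Phi$ is automatic, from $M \le K^2 N$.  The lower frame bound
  $M \ge \alpha \|\Theta^* f\|^2$ is equivalent to $M \ge \lambda N$: hyponormality turns the former
  into $M \ge \alpha \|\Theta f\|^2$, which dominates a multiple of $N$ by the upper bound for $N$,
  and conversely $\lambda N$ dominates a multiple of $\|\Theta^* f\|^2$ by the lower bound for $N$.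
\<close>

lemma cinner_commute: "cinner f g = cnj (cinner g f)"
proof transfer
  fix f g :: "real \<Rightarrow> complex"
  show "(\<integral>x. f x * cnj (g x) \<partial>lborel) = cnj (\<integral>x. g x * cnj (f x) \<partial>lborel)"
    unfolding Bochner_Integration.integral_cnj[symmetric] by (simp add: mult.commute)
qed

lemma cmod_cinner_commute: "cmod (cinner f g) = cmod (cinner g f)"
  by (subst cinner_commute) simp

lemma cinner_cadjoint:
  assumes "bounded_clinear S"
  shows "cinner (S f) g = cinner f (cadjoint S g)"
  using theI'[OF cadjoint_ex1[OF assms]] unfolding cadjoint_def by blast

text \<open>
  Any map satisfying the adjoint identity is the adjoint.  This identifies \<open>cadjoint S\<close> without
  \<open>S\<close> being known to be bounded, so that it applies to an \<open>S\<close> that is itself an adjoint.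
\<close>

lemma cadjoint_eqI:
  assumes adj: "\<And>f g. cinner (S f) g = cinner f (S' g)"
  shows "cadjoint S = S'"
  unfolding cadjoint_def
proof (rule the_equality)
  fix S'' assume adj': "\<forall>f g. cinner (S f) g = cinner f (S'' g)"
  show "S'' = S'"
  proof
    fix g
    have "inner f (S'' g) = inner f (S' g)" for f
      using adj adj' by (simp add: inner_L2_def)
    then have "inner f (S'' g - S' g) = 0" for f
      by (simp add: inner_diff_right)
    from this[of "S'' g - S' g"] show "S'' g = S' g"
      by simp
  qed
qed (use adj in blast)

lemma cadjoint_cadjoint:
  assumes "bounded_clinear S"
  shows "cadjoint (cadjoint S) = S"
  by (rule cadjoint_eqI) (metis assms cinner_cadjoint cinner_commute)

lemma hyponormal_cadjoint_norm_le:
  assumes "bounded_clinear S" "hyponormal (cadjoint S)"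
  shows "norm (S f) \<le> norm (cadjoint S f)"
  using assms by (simp add: hyponormal_def cadjoint_cadjoint)

text \<open>
  Square sums in $[0,\infty]$ and in \<open>ell2\<close> agree: the next two lemmas allow passing from the
  former, in which frames are expressed, to the latter, on which \<open>T\<close> acts, and back.
\<close>

lemma infsum_ennreal_eq:
  fixes f :: "'a \<Rightarrow> real"
  assumes "\<And>x. f x \<ge> 0" "f summable_on A"
  shows "(\<Sum>\<^sub>\<infinity>x\<in>A. ennreal (f x)) = ennreal (\<Sum>\<^sub>\<infinity>x\<in>A. f x)"
proof -
  have "(\<Sum>\<^sub>\<infinity>x\<in>A. ennreal (f x)) = (SUP F\<in>{F. finite F \<and> F \<subseteq> A}. sum (\<lambda>x. ennreal (f x)) F)"
    by (rule nonneg_infsum_complete) simp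
  also have "\<dots> = (SUP F\<in>{F. finite F \<and> F \<subseteq> A}. ennreal (sum f F))"
    using assms(1) by (simp add: sum_ennreal)
  also have "\<dots> = ennreal (\<Sum>\<^sub>\<infinity>x\<in>A. f x)"
    using assms by (intro infsum_nonneg_is_SUPREMUM_ennreal[symmetric]) auto
  finally show ?thesis .
qed

lemma summable_on_if_infsum_ennreal_finite:
  fixes f :: "'a \<Rightarrow> real"
  assumes nonneg: "\<And>x. f x \<ge> 0" and fin: "(\<Sum>\<^sub>\<infinity>x\<in>A. ennreal (f x)) < \<infinity>"
  shows "f summable_on A"
proof (rule nonneg_bdd_above_summable_on)
  obtain B where B: "B \<ge> 0" "(\<Sum>\<^sub>\<infinity>x\<in>A. ennreal (f x)) = ennreal B"
    using fin by (cases "\<Sum>\<^sub>\<infinity>x\<in>A. ennreal (f x)") auto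
  have "sum f F \<le> B" if F: "F \<subseteq> A" "finite F" for F
  proof -
    have "ennreal (sum f F) = (\<Sum>\<^sub>\<infinity>x\<in>F. ennreal (f x))"
      using F nonneg by (simp add: sum_ennreal)
    also have "\<dots> \<le> (\<Sum>\<^sub>\<infinity>x\<in>A. ennreal (f x))"
      using F by (intro infsum_mono_neutral) (auto intro: nonneg_summable_on_complete)
    finally show ?thesis
      using B by simp
  qed
  then show "bdd_above (sum f ` {F. F \<subseteq> A \<and> finite F})"
    by (auto simp: bdd_above_def)
qed (use nonneg in auto)

lemma ell2_square_sum:
  assumes "x \<in> ell2"
  shows "(\<Sum>\<^sub>\<infinity>i. ennreal ((cmod (x i))\<^sup>2)) = ennreal ((ell2_norm x)\<^sup>2)"
proof -
  have "(ell2_norm x)\<^sup>2 = (\<Sum>\<^sub>\<infinity>i. (cmod (x i))\<^sup>2)"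
    by (simp add: ell2_norm_def infsum_nonneg)
  then show ?thesis
    using assms by (simp add: ell2_def infsum_ennreal_eq)
qed

lemma bounded_clinear_ell2_square_sum_le:
  assumes "bounded_clinear_ell2 T"
  obtains K :: real where "\<And>x. x \<in> ell2 \<Longrightarrow>
    (\<Sum>\<^sub>\<infinity>i. ennreal ((cmod (T x i))\<^sup>2)) \<le> ennreal (K\<^sup>2) * (\<Sum>\<^sub>\<infinity>i. ennreal ((cmod (x i))\<^sup>2))"
proof -
  obtain K where K: "\<And>x. x \<in> ell2 \<Longrightarrow> ell2_norm (T x) \<le> K * ell2_norm x"
    using assms unfolding bounded_clinear_ell2_def by blast
  have "(\<Sum>\<^sub>\<infinity>i. ennreal ((cmod (T x i))\<^sup>2)) \<le> ennreal (K\<^sup>2) * (\<Sum>\<^sub>\<infinity>i. ennreal ((cmod (x i))\<^sup>2))"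
    if x: "x \<in> ell2" for x
  proof -
    have Tx: "T x \<in> ell2"
      using assms x by (simp add: bounded_clinear_ell2_def)
    have "0 \<le> ell2_norm (T x)"
      by (simp add: ell2_norm_def infsum_nonneg)
    then have "(ell2_norm (T x))\<^sup>2 \<le> K\<^sup>2 * (ell2_norm x)\<^sup>2"
      using power_mono[OF K[OF x], of 2] by (simp add: power_mult_distrib)
    then show ?thesis
      by (simp add: ell2_square_sum x Tx ennreal_leI flip: ennreal_mult)
  qed
  then show thesis
    by (rule that)
qed

theorem theorem4p1:
  fixes \<psi> :: L2
    and a c :: "int \<Rightarrow> real"
    and b :: real
    and \<Theta> :: "L2 \<Rightarrow> L2"
    and I :: "int \<times> int \<times> int \<Rightarrow> (int \<times> int \<times> int) set"
    and \<alpha> :: "int \<times> int \<times> int \<Rightarrow> complex"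
    and \<Phi> :: "int \<times> int \<times> int \<Rightarrow> L2"
    and T :: "(int \<times> int \<times> int \<Rightarrow> complex) \<Rightarrow> (int \<times> int \<times> int \<Rightarrow> complex)"
  assumes "\<And>j. a j > 0"
    and "b \<noteq> 0"
    and "bounded_clinear \<Theta>"
    and "hyponormal (cadjoint \<Theta>)"
    and "IWH_frame \<Theta> (wave_packet \<psi> a b c)"
    and "(\<Union>r. I r) = UNIV"
    and "\<And>r r'. r \<noteq> r' \<Longrightarrow> I r \<inter> I r' = {}"
    and "\<And>r. ((\<lambda>i. \<alpha> i *\<^sub>C wave_packet \<psi> a b c i) has_sum \<Phi> r) (I r)"
    and "bounded_clinear_ell2 T"
    and "\<And>f. T (\<lambda>i. cinner (wave_packet \<psi> a b c i) f) = (\<lambda>r. cinner (\<Phi> r) f)"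
  shows "IWH_frame \<Theta> \<Phi> \<longleftrightarrow>
    (\<exists>\<kappa>>0. \<forall>f.
       (\<Sum>\<^sub>\<infinity>r. ennreal ((cmod (cinner (\<Phi> r) f))\<^sup>2))
         \<ge> ennreal \<kappa> * (\<Sum>\<^sub>\<infinity>i. ennreal ((cmod (cinner (wave_packet \<psi> a b c i) f))\<^sup>2)))"
proof -
  define g where "g = wave_packet \<psi> a b c"
  define N where "N f = (\<Sum>\<^sub>\<infinity>i. ennreal ((cmod (cinner (g i) f))\<^sup>2))" for f
  define M where "M f = (\<Sum>\<^sub>\<infinity>r. ennreal ((cmod (cinner (\<Phi> r) f))\<^sup>2))" for f
  have frame: "IWH_frame \<Theta> h \<longleftrightarrow> (\<exists>\<alpha>\<^sub>0 \<beta>\<^sub>0 :: real. 0 < \<alpha>\<^sub>0 \<and> \<alpha>\<^sub>0 \<le> \<beta>\<^sub>0 \<and>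
       (\<forall>f. ennreal (\<alpha>\<^sub>0 * (norm (cadjoint \<Theta> f))\<^sup>2) \<le> (\<Sum>\<^sub>\<infinity>i. ennreal ((cmod (cinner (h i) f))\<^sup>2)) \<and>
            (\<Sum>\<^sub>\<infinity>i. ennreal ((cmod (cinner (h i) f))\<^sup>2)) \<le> ennreal (\<beta>\<^sub>0 * (norm (\<Theta> f))\<^sup>2)))" for h
    unfolding IWH_frame_def by (subst (1 2) cmod_cinner_commute) (rule refl)
  obtain \<alpha>\<^sub>0 \<beta>\<^sub>0 :: real where \<alpha>\<^sub>0: "0 < \<alpha>\<^sub>0" and \<beta>\<^sub>0: "\<alpha>\<^sub>0 \<le> \<beta>\<^sub>0"
    and N_lower: "\<And>f. ennreal (\<alpha>\<^sub>0 * (norm (cadjoint \<Theta> f))\<^sup>2) \<le> N f"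
    and N_upper: "\<And>f. N f \<le> ennreal (\<beta>\<^sub>0 * (norm (\<Theta> f))\<^sup>2)"
    using assms(5) unfolding frame N_def g_def by blast
  have hyp: "norm (\<Theta> f) \<le> norm (cadjoint \<Theta> f)" for f
    using assms(3,4) by (rule hyponormal_cadjoint_norm_le)
  obtain K where K: "\<And>x. x \<in> ell2 \<Longrightarrow>
      (\<Sum>\<^sub>\<infinity>i. ennreal ((cmod (T x i))\<^sup>2)) \<le> ennreal (K\<^sup>2) * (\<Sum>\<^sub>\<infinity>i. ennreal ((cmod (x i))\<^sup>2))"
    using bounded_clinear_ell2_square_sum_le[OF assms(9)] by blast
  have M_le_N: "M f \<le> ennreal (K\<^sup>2) * N f" for f
  proof -
    have "N f < \<infinity>"
      using order_le_less_trans[OF N_upper[of f], of \<infinity>] by simp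
    then have "(\<lambda>i. cinner (g i) f) \<in> ell2"
      unfolding ell2_def N_def by (auto intro: summable_on_if_infsum_ennreal_finite)
    from K[OF this] show ?thesis
      using assms(10)[of f] by (simp add: M_def N_def g_def)
  qed
  have "IWH_frame \<Theta> \<Phi> \<longleftrightarrow> (\<exists>\<kappa>>0. \<forall>f. ennreal \<kappa> * N f \<le> M f)"
  proof
    assume "IWH_frame \<Theta> \<Phi>"
    then obtain \<alpha>\<^sub>1 where \<alpha>\<^sub>1: "0 < \<alpha>\<^sub>1"
      and M_lower: "\<And>f. ennreal (\<alpha>\<^sub>1 * (norm (cadjoint \<Theta> f))\<^sup>2) \<le> M f"
      unfolding frame M_def by blast
    have "ennreal (\<alpha>\<^sub>1 / \<beta>\<^sub>0) * N f \<le> M f" for f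
    proof -
      have "ennreal (\<alpha>\<^sub>1 / \<beta>\<^sub>0) * N f \<le> ennreal (\<alpha>\<^sub>1 / \<beta>\<^sub>0) * ennreal (\<beta>\<^sub>0 * (norm (\<Theta> f))\<^sup>2)"
        by (intro mult_left_mono N_upper) simp
      also have "\<dots> = ennreal (\<alpha>\<^sub>1 * (norm (\<Theta> f))\<^sup>2)"
        using \<alpha>\<^sub>0 \<beta>\<^sub>0 \<alpha>\<^sub>1 by (simp flip: ennreal_mult)
      also have "\<dots> \<le> ennreal (\<alpha>\<^sub>1 * (norm (cadjoint \<Theta> f))\<^sup>2)"
        using \<alpha>\<^sub>1 hyp[of f] by (intro ennreal_leI mult_left_mono power_mono) auto
      also have "\<dots> \<le> M f"
        by (rule M_lower)
      finally show ?thesis .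
    qed
    moreover have "\<alpha>\<^sub>1 / \<beta>\<^sub>0 > 0"
      using \<alpha>\<^sub>0 \<beta>\<^sub>0 \<alpha>\<^sub>1 by simp
    ultimately show "\<exists>\<kappa>>0. \<forall>f. ennreal \<kappa> * N f \<le> M f"
      by blast
  next
    assume "\<exists>\<kappa>>0. \<forall>f. ennreal \<kappa> * N f \<le> M f"
    then obtain \<kappa> where \<kappa>: "\<kappa> > 0" "\<And>f. ennreal \<kappa> * N f \<le> M f"
      by blast
    have lower: "ennreal (\<kappa> * \<alpha>\<^sub>0 * (norm (cadjoint \<Theta> f))\<^sup>2) \<le> M f" for f
    proof -
      have "ennreal (\<kappa> * \<alpha>\<^sub>0 * (norm (cadjoint \<Theta> f))\<^sup>2)
          = ennreal \<kappa> * ennreal (\<alpha>\<^sub>0 * (norm (cadjoint \<Theta> f))\<^sup>2)"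
        using \<alpha>\<^sub>0 \<kappa>(1) by (simp add: mult.assoc flip: ennreal_mult)
      also have "\<dots> \<le> ennreal \<kappa> * N f"
        by (intro mult_left_mono N_lower) simp
      also have "\<dots> \<le> M f"
        by (rule \<kappa>(2))
      finally show ?thesis .
    qed
    \<comment> \<open>The first summand alone is an upper bound; the second makes the constant at least the lower
      one, which for \<open>\<Theta> = 0\<close> would not follow from the inequalities.\<close>
    have upper: "M f \<le> ennreal ((K\<^sup>2 * \<beta>\<^sub>0 + \<kappa> * \<alpha>\<^sub>0) * (norm (\<Theta> f))\<^sup>2)" for f
    proof -
      have "M f \<le> ennreal (K\<^sup>2) * ennreal (\<beta>\<^sub>0 * (norm (\<Theta> f))\<^sup>2)"
        by (rule order_trans[OF M_le_N]) (intro mult_left_mono N_upper, simp)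
      also have "\<dots> = ennreal (K\<^sup>2 * \<beta>\<^sub>0 * (norm (\<Theta> f))\<^sup>2)"
        using \<alpha>\<^sub>0 \<beta>\<^sub>0 by (simp add: mult.assoc flip: ennreal_mult)
      also have "\<dots> \<le> ennreal ((K\<^sup>2 * \<beta>\<^sub>0 + \<kappa> * \<alpha>\<^sub>0) * (norm (\<Theta> f))\<^sup>2)"
        using \<alpha>\<^sub>0 \<kappa>(1) by (intro ennreal_leI mult_right_mono) auto
      finally show ?thesis .
    qed
    have "0 < \<kappa> * \<alpha>\<^sub>0" "\<kappa> * \<alpha>\<^sub>0 \<le> K\<^sup>2 * \<beta>\<^sub>0 + \<kappa> * \<alpha>\<^sub>0"
      using \<alpha>\<^sub>0 \<beta>\<^sub>0 \<kappa>(1) by auto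
    with lower upper show "IWH_frame \<Theta> \<Phi>"
      unfolding frame M_def by blast
  qed
  then show ?thesis
    by (simp only: M_def N_def g_def)
qed

end
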